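(* Let $G$ be a finite connected graph with $n$ vertices and $m$ edges, carrying data $H_{uu}$, $h$, $\gamma$ defining the Hermitian matrix $\mathbf{H}$ as in the context, let $\Gamma$ be a finite group and $\alpha:D(G)\to\Gamma$ an ordinary voltage assignment. Let $\rho$ be a unitary representation of $\Gamma$ of degree $d$, and let $\lambda\in\mathbb{C}$ with $H_{uu}-\lambda-i\Gamma_u\ne0$ for all $u$. Then \[ \mathbf{Z}_H(G,\lambda,\rho,\alpha)^{-1}=\frac{2^{md}(-1)^{nd}}{\prod_{u\in V(G)}(H_{uu}-\lambda-i\Gamma_u)^d}\det\Bigl(\lambda\mathbf{I}_{nd}-\sum_{g\in\Gamma}\rho(g)\otimes\mathbf{H}_g-\mathbf{I}_d\otimes\mathrm{diag}(\mathbf{H})\Bigr), \] where $\mathrm{diag}(\mathbf{H})$ is the diagonal matrix with the diagonal entries of $\mathbf{H}$.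
   Context: $G$ is a finite connected graph without loops or multiple edges; $D(G)$ is its set of arcs; for $e=(u,v)$, $o(e)=u$, $t(e)=v$, $e^{-1}=(v,u)$. Data: real numbers $H_{uu}$ ($u\in V(G)$), $h:D(G)\to[0,\infty)$, $\gamma:D(G)\to[-\pi/2,\pi/2]$ with $h_{f^{-1}}=h_f$, $\gamma_{f^{-1}}=-\gamma_f$; write $h_{uv}=h_{(u,v)}$, $\gamma_{uv}=\gamma_{(u,v)}$. $\mathbf{H}=(H_{uv})$ has diagonal $H_{uu}$ and, for $u\ne v$, $H_{uv}=h_{uv}e^{2i\gamma_{uv}}$ if $(u,v)\in D(G)$, else $0$. $\Gamma_u=\sum_{o(f)=u}h_f$. $\sigma^{(u)}_{ef}(\lambda)=i\delta_{e^{-1},f}-2\frac{\sqrt{h_e}\sqrt{h_f}}{H_{uu}-\lambda-i\Gamma_u}e^{i(\gamma_f+\gamma_e)}$ ($\delta$ Kronecker delta). An ordinary voltage assignment is a map $\alpha:D(G)\to\Gamma$ with $\alpha(v,u)=\alpha(u,v)^{-1}$. For $g\in\Gamma$: $\mathbf{H}_g$ is the $n\times n$ matrix with $(u,v)$-entry $h_{uv}e^{2i\gamma_{uv}}$ if $(u,v)\in D(G)$ and $\alpha(u,v)=g$, else $0$; $\mathbf{U}_g$ is the $2m\times2m$ matrix indexed by $D(G)$ with $(e,f)$-entry $\sigma^{(t(e))}_{ef}(\lambda)$ if $t(e)=o(f)$ and $\alpha(e)=g$, else $0$. The $L$-function is $\mathbf{Z}_H(G,\lambda,\rho,\alpha)=\det\bigl(\mathbf{I}_{2md}-\sum_{h\in\Gamma}\rho(h)\otimes\mathbf{U}_h\bigr)^{-1}$,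 where $\otimes$ is the Kronecker product. *)

theory Defs
  imports
    "HOL-Algebra.Group"
    "Jordan_Normal_Form.Schur_Decomposition"
    "Graph_Theory.Digraph_Component"
    "Graph_Theory.Pair_Digraph"
begin

text \<open>
  A finite simple graph is a \<^locale>\<open>pair_graph\<close>: its arc set \<^term>\<open>parcs G\<close> is the
  symmetric irreflexive relation \<open>D(G)\<close>, with \<open>o = fst\<close>, \<open>t = snd\<close> and
  \<open>e\<^sup>-\<^sup>1 = prod.swap e\<close>. Matrices indexed by \<open>V(G)\<close> or \<open>D(G)\<close> are formed with respect to an
  enumeration of the index set as a distinct list.
\<close>

definition edges :: "'v pair_pre_digraph \<Rightarrow> 'v set set" where
  "edges G = (\<lambda>(u, v). {u, v}) ` parcs G"

definition enumerates :: "'a list \<Rightarrow> 'a set \<Rightarrow> bool" where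
  "enumerates xs A \<longleftrightarrow> distinct xs \<and> set xs = A"

definition indexed_mat :: "'a list \<Rightarrow> ('a \<Rightarrow> 'a \<Rightarrow> 'b) \<Rightarrow> 'b mat" where
  "indexed_mat xs f = mat (length xs) (length xs) (\<lambda>(i, j). f (xs ! i) (xs ! j))"

definition kronecker :: "'a :: semiring_0 mat \<Rightarrow> 'a mat \<Rightarrow> 'a mat" (infixl "\<otimes>\<^sub>K" 70) where
  "A \<otimes>\<^sub>K B = mat (dim_row A * dim_row B) (dim_col A * dim_col B)
     (\<lambda>(i, j). A $$ (i div dim_row B, j div dim_col B) * B $$ (i mod dim_row B, j mod dim_col B))"

definition msum :: "nat \<Rightarrow> ('g \<Rightarrow> complex mat) \<Rightarrow> 'g set \<Rightarrow> complex mat" where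
  "msum k F A = finsum (module_mat TYPE(complex) k k) F A"

definition unitary_group :: "nat \<Rightarrow> complex mat monoid" where
  "unitary_group d =
     \<lparr>carrier = {A \<in> carrier_mat d d. mat_adjoint A * A = 1\<^sub>m d \<and> A * mat_adjoint A = 1\<^sub>m d},
      monoid.mult = (*), one = 1\<^sub>m d\<rparr>"

definition voltage_assignment ::
    "'v pair_pre_digraph \<Rightarrow> ('g, 'b) monoid_scheme \<Rightarrow> ('v \<times> 'v \<Rightarrow> 'g) \<Rightarrow> bool" where
  "voltage_assignment G \<Gamma> \<alpha> \<longleftrightarrow>
     (\<forall>e \<in> parcs G. \<alpha> e \<in> carrier \<Gamma> \<and> \<alpha> (prod.swap e) = inv\<^bsub>\<Gamma>\<^esub> (\<alpha> e))"

text \<open>The vertex weight \<open>\<Gamma>\<^sub>u\<close>.\<close>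

definition vweight :: "'v pair_pre_digraph \<Rightarrow> ('v \<times> 'v \<Rightarrow> real) \<Rightarrow> 'v \<Rightarrow> real" where
  "vweight G h u = (\<Sum>f \<in> {f \<in> parcs G. fst f = u}. h f)"

text \<open>The argument \<open>Hd\<close> below is the family of diagonal entries \<open>H\<^sub>u\<^sub>u\<close>.\<close>

definition H_mat ::
    "'v pair_pre_digraph \<Rightarrow> ('v \<Rightarrow> real) \<Rightarrow> ('v \<times> 'v \<Rightarrow> real) \<Rightarrow> ('v \<times> 'v \<Rightarrow> real)
      \<Rightarrow> 'v list \<Rightarrow> complex mat" where
  "H_mat G Hd h \<gamma> vs = indexed_mat vs (\<lambda>u v.
     if u = v then of_real (Hd u)
     else if (u, v) \<in> parcs G
       then of_real (h (u, v)) * exp (2 * \<i> * of_real (\<gamma> (u, v)))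
     else 0)"

definition Hg_mat ::
    "'v pair_pre_digraph \<Rightarrow> ('v \<times> 'v \<Rightarrow> real) \<Rightarrow> ('v \<times> 'v \<Rightarrow> real) \<Rightarrow> ('v \<times> 'v \<Rightarrow> 'g)
      \<Rightarrow> 'v list \<Rightarrow> 'g \<Rightarrow> complex mat" where
  "Hg_mat G h \<gamma> \<alpha> vs g = indexed_mat vs (\<lambda>u v.
     if (u, v) \<in> parcs G \<and> \<alpha> (u, v) = g
       then of_real (h (u, v)) * exp (2 * \<i> * of_real (\<gamma> (u, v)))
     else 0)"

definition diag_part :: "'a :: zero mat \<Rightarrow> 'a mat" where
  "diag_part A = mat_diag (dim_row A) (\<lambda>i. A $$ (i, i))"

definition scattering ::
    "'v pair_pre_digraph \<Rightarrow> ('v \<Rightarrow> real) \<Rightarrow> ('v \<times> 'v \<Rightarrow> real) \<Rightarrow> ('v \<times> 'v \<Rightarrow> real) \<Rightarrow> complex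
      \<Rightarrow> 'v \<Rightarrow> 'v \<times> 'v \<Rightarrow> 'v \<times> 'v \<Rightarrow> complex" where
  "scattering G Hd h \<gamma> z u e f =
     \<i> * (if prod.swap e = f then 1 else 0)
     - 2 * (of_real (sqrt (h e)) * of_real (sqrt (h f))
            / (of_real (Hd u) - z - \<i> * of_real (vweight G h u)))
         * exp (\<i> * of_real (\<gamma> f + \<gamma> e))"

definition Ug_mat ::
    "'v pair_pre_digraph \<Rightarrow> ('v \<Rightarrow> real) \<Rightarrow> ('v \<times> 'v \<Rightarrow> real) \<Rightarrow> ('v \<times> 'v \<Rightarrow> real) \<Rightarrow> complex
      \<Rightarrow> ('v \<times> 'v \<Rightarrow> 'g) \<Rightarrow> ('v \<times> 'v) list \<Rightarrow> 'g \<Rightarrow> complex mat" where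
  "Ug_mat G Hd h \<gamma> z \<alpha> es g = indexed_mat es (\<lambda>e f.
     if snd e = fst f \<and> \<alpha> e = g then scattering G Hd h \<gamma> z (snd e) e f else 0)"

text \<open>
  The number of arcs is \<open>length es = 2m\<close>. Where the determinant vanishes, \<open>Z\<close> is infinite and
  its reciprocal is \<open>0\<close>; the convention \<open>inverse 0 = 0\<close> gives the same value of
  \<open>inverse (L_function \<dots>)\<close>.
\<close>

definition L_function ::
    "'v pair_pre_digraph \<Rightarrow> ('v \<Rightarrow> real) \<Rightarrow> ('v \<times> 'v \<Rightarrow> real) \<Rightarrow> ('v \<times> 'v \<Rightarrow> real)
      \<Rightarrow> ('v \<times> 'v) list \<Rightarrow> ('g, 'b) monoid_scheme \<Rightarrow> complex \<Rightarrow> nat \<Rightarrow> ('g \<Rightarrow> complex mat)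
      \<Rightarrow> ('v \<times> 'v \<Rightarrow> 'g) \<Rightarrow> complex" where
  "L_function G Hd h \<gamma> es \<Gamma> z d \<rho> \<alpha> =
     inverse (det (1\<^sub>m (length es * d)
       - msum (length es * d) (\<lambda>g. \<rho> g \<otimes>\<^sub>K Ug_mat G Hd h \<gamma> z \<alpha> es g) (carrier \<Gamma>)))"

end

theory Submission
  imports Defs
begin

text \<open>
  Write \<open>X\<^sub>u = H\<^sub>u\<^sub>u - \<lambda> - i \<Gamma>\<^sub>u\<close> and \<open>s\<^sub>e = \<surd>h\<^sub>e exp (i \<gamma>\<^sub>e)\<close>. The edge matrix
  \<open>\<Sum> \<rho>(g) \<otimes> U\<^sub>g\<close> equals \<open>i P - 2 K L\<close>, where \<open>P\<close> is arc reversal twisted by \<open>\<rho> \<circ> \<alpha>\<close>, \<open>K\<close> sends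
  arcs to their heads (weights \<open>\<rho>(\<alpha>(e)) s\<^sub>e / X\<^sub>v\<close>) and \<open>L\<close> sends vertices to the arcs leaving them
  (weights \<open>s\<^sub>f\<close>). Since \<open>P\<^sup>2 = 1\<close>, we have \<open>(1 - i P)(1 + i P) = 2\<close>, so
  \<open>det (1 - i P + 2 K L) = det (1 - i P) det (1 + L (1 + i P) K)\<close> by Sylvester's determinant identity.
  Here \<open>L K\<close> is \<open>\<Sum> \<rho>(g) \<otimes> H\<^sub>g\<close> with columns divided by \<open>X\<^sub>v\<close>, and \<open>L P K\<close> is diagonal with entries
  \<open>\<Gamma>\<^sub>v / X\<^sub>v\<close>, which turns the last factor into the determinant on the vertices.
  Finally \<open>det (1 - i P) = 2\<^sup>m\<^sup>d\<close>: with \<open>E\<close> the projection onto the arcs of an orientation,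
  \<open>(1 - i P)(1 + i P E) = (1 + E)(1 - (i/2) E P)\<close>, and \<open>P E\<close>, \<open>E P\<close> square to zero.
\<close>

section \<open>Matrices indexed by the entries of lists\<close>

text \<open>Row and column index sets may differ, as maps between arcs and vertices require. Matrix
  algebra reduces to identities between entry functions, without list positions.\<close>

definition rect_mat :: "'a list \<Rightarrow> 'b list \<Rightarrow> ('a \<Rightarrow> 'b \<Rightarrow> 'c) \<Rightarrow> 'c mat" where
  "rect_mat xs ys f = mat (length xs) (length ys) (\<lambda>(i, j). f (xs ! i) (ys ! j))"

lemma rect_mat_carrier [simp]: "rect_mat xs ys f \<in> carrier_mat (length xs) (length ys)"
  by (simp add: rect_mat_def)

lemma rect_mat_dim [simp]:
  "dim_row (rect_mat xs ys f) = length xs" "dim_col (rect_mat xs ys f) = length ys"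
  by (simp_all add: rect_mat_def)

lemma rect_mat_cong:
  assumes "\<And>x y. x \<in> set xs \<Longrightarrow> y \<in> set ys \<Longrightarrow> f x y = g x y"
  shows "rect_mat xs ys f = rect_mat xs ys g"
  using assms by (auto simp: rect_mat_def)

lemma rect_mat_mult:
  fixes f :: "'a \<Rightarrow> 'b \<Rightarrow> 'c :: semiring_0"
  assumes "distinct ys"
  shows "rect_mat xs ys f * rect_mat ys zs g = rect_mat xs zs (\<lambda>x z. \<Sum>y\<in>set ys. f x y * g y z)"
proof (rule eq_matI)
  fix i j
  assume "i < dim_row (rect_mat xs zs (\<lambda>x z. \<Sum>y\<in>set ys. f x y * g y z))"
    and "j < dim_col (rect_mat xs zs (\<lambda>x z. \<Sum>y\<in>set ys. f x y * g y z))"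
  moreover have "(\<Sum>k = 0..<length ys. f x (ys ! k) * g (ys ! k) z) = (\<Sum>y\<in>set ys. f x y * g y z)" for x z
    by (rule sum.reindex_bij_betw) (use assms in \<open>simp add: bij_betw_nth atLeast0LessThan\<close>)
  ultimately show "(rect_mat xs ys f * rect_mat ys zs g) $$ (i, j) =
      rect_mat xs zs (\<lambda>x z. \<Sum>y\<in>set ys. f x y * g y z) $$ (i, j)"
    by (simp add: rect_mat_def scalar_prod_def)
qed simp_all

lemma rect_mat_add: "rect_mat xs ys f + rect_mat xs ys g = rect_mat xs ys (\<lambda>x y. f x y + g x y)"
  by (auto simp: rect_mat_def)

lemma rect_mat_minus: "rect_mat xs ys f - rect_mat xs ys g = rect_mat xs ys (\<lambda>x y. f x y - g x y)"
  by (auto simp: rect_mat_def)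

lemma rect_mat_smult: "c \<cdot>\<^sub>m rect_mat xs ys f = rect_mat xs ys (\<lambda>x y. c * f x y)"
  by (auto simp: rect_mat_def)

lemma rect_mat_zero: "0\<^sub>m (length xs) (length ys) = rect_mat xs ys (\<lambda>x y. 0)"
  by (auto simp: rect_mat_def)

lemma rect_mat_one:
  assumes "distinct xs"
  shows "1\<^sub>m (length xs) = rect_mat xs xs (\<lambda>x y. if x = y then 1 else 0)"
  by (rule eq_matI) (use assms in \<open>auto simp: rect_mat_def nth_eq_iff_index_eq\<close>)

lemma det_rect_mat_diag:
  fixes c :: "'a \<Rightarrow> 'b :: comm_ring_1"
  assumes "distinct xs"
  shows "det (rect_mat xs xs (\<lambda>x y. if x = y then c x else 0)) = (\<Prod>x\<in>set xs. c x)"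
proof -
  let ?A = "rect_mat xs xs (\<lambda>x y. if x = y then c x else 0)"
  have "upper_triangular ?A"
    using assms by (auto simp: upper_triangular_def rect_mat_def nth_eq_iff_index_eq)
  then have "det ?A = (\<Prod>i = 0..<length xs. ?A $$ (i, i))"
    by (subst det_upper_triangular[of _ "length xs"]) (auto simp: prod_list_diag_prod)
  also have "\<dots> = (\<Prod>i = 0..<length xs. c (xs ! i))"
    by (rule prod.cong) (auto simp: rect_mat_def)
  also have "\<dots> = (\<Prod>x\<in>set xs. c x)"
    by (rule prod.reindex_bij_betw) (use assms in \<open>simp add: bij_betw_nth atLeast0LessThan\<close>)
  finally show ?thesis .
qed

section \<open>Determinant identities\<close>

text \<open>Sylvester's identity: \<open>?T * ?M\<close> and \<open>?M * ?T\<close> have the same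
  determinant, and both are block lower triangular with an identity diagonal block.\<close>

lemma det_one_add_mult_commute:
  fixes X :: "'a :: idom mat"
  assumes X: "X \<in> carrier_mat k l" and Y: "Y \<in> carrier_mat l k"
  shows "det (1\<^sub>m k + X * Y) = det (1\<^sub>m l + Y * X)"
proof -
  let ?M = "four_block_mat (1\<^sub>m k) (- X) Y (1\<^sub>m l)"
  let ?T = "four_block_mat (1\<^sub>m k) X (0\<^sub>m l k) (1\<^sub>m l)"
  have TM: "?T * ?M = four_block_mat (1\<^sub>m k + X * Y) (0\<^sub>m k l) Y (1\<^sub>m l)"
    by (subst mult_four_block_mat[of _ k k _ l _ l _ _ k _ l]) (use X Y in auto)
  have MT: "?M * ?T = four_block_mat (1\<^sub>m k) (0\<^sub>m k l) Y (1\<^sub>m l + Y * X)"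
    by (subst mult_four_block_mat[of _ k k _ l _ l _ _ k _ l])
      (use X Y in \<open>auto simp: comm_add_mat[of "Y * X" l l]\<close>)
  have "?M \<in> carrier_mat (k + l) (k + l)" "?T \<in> carrier_mat (k + l) (k + l)"
    using X Y by auto
  then have "det (?T * ?M) = det (?M * ?T)"
    by (simp add: det_mult[of _ "k + l"] mult.commute)
  moreover have "det (?T * ?M) = det (1\<^sub>m k + X * Y)"
    unfolding TM by (subst det_four_block_mat_upper_right_zero[of _ k _ l]) (use X Y in auto)
  moreover have "det (?M * ?T) = det (1\<^sub>m l + Y * X)"
    unfolding MT by (subst det_four_block_mat_upper_right_zero[of _ k _ l]) (use X Y in auto)
  ultimately show ?thesis by simp
qed

text \<open>Sylvester's identity applies to \<open>E\<close> and \<open>N\<close>: one of their two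
  products is \<open>N\<close>, the other is 0.\<close>

lemma det_one_add_idempotent_nilpotent:
  fixes N :: "'a :: idom mat"
  assumes E: "E \<in> carrier_mat k k" and N: "N \<in> carrier_mat k k"
    and "N * E = N \<and> E * N = 0\<^sub>m k k \<or> E * N = N \<and> N * E = 0\<^sub>m k k"
  shows "det (1\<^sub>m k + N) = 1"
  using assms det_one_add_mult_commute[OF E N] by auto

text \<open>With respect to the projection \<open>E\<close>, the last two hypotheses make both
  diagonal blocks of \<open>P\<close> vanish. In the factorization the second factor on each side
  has determinant 1, so only \<open>1 + E\<close> is left.\<close>

lemma det_one_minus_i_involution:
  fixes P :: "complex mat"
  assumes P: "P \<in> carrier_mat k k" and E: "E \<in> carrier_mat k k"
    and PP: "P * P = 1\<^sub>m k" and EE: "E * E = E" and EPE: "E * P * E = 0\<^sub>m k k"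
    and EP: "E * P + P * E = P"
  shows "det (1\<^sub>m k + (- \<i>) \<cdot>\<^sub>m P) = det (1\<^sub>m k + E)"
proof -
  note [simp] = P E carrier_matD[OF P] carrier_matD[OF E] mult_carrier_mat[of _ k k]
  note distrib = add_mult_distrib_mat[of _ k k _ _ k] mult_add_distrib_mat[of _ k k _ k]
    mult_smult_distrib[of _ k k _ k] mult_smult_assoc_mat[of _ k k _ k]
  have PPE: "P * (P * E) = E"
    using PP left_mult_one_mat[OF E] by (simp flip: assoc_mult_mat[of P k k P k E k])
  have EEP: "E * (E * P) = E * P"
    using EE by (simp flip: assoc_mult_mat[of E k k E k P k])
  have PEE: "P * E * E = P * E"
    using EE by (simp add: assoc_mult_mat[of P k k E k E k])
  have EPE': "E * (P * E) = 0\<^sub>m k k"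
    using EPE by (simp add: assoc_mult_mat[of E k k P k E k])
  have "(1\<^sub>m k + (- \<i>) \<cdot>\<^sub>m P) * (1\<^sub>m k + \<i> \<cdot>\<^sub>m (P * E))
      = 1\<^sub>m k + \<i> \<cdot>\<^sub>m (P * E) + ((- \<i>) \<cdot>\<^sub>m P + E)"
    by (simp add: distrib PPE left_mult_one_mat[of "P * E" k k] right_mult_one_mat[of P k k], rule eq_matI)
      (auto simp: algebra_simps simp del: index_mult_mat(1))
  \<comment> \<open>Replacing \<open>P\<close> by \<open>E * P + P * E\<close> cancels the term in
    \<open>P * E\<close>.\<close>
  also have "\<dots> = 1\<^sub>m k + E + (- \<i>) \<cdot>\<^sub>m (E * P)"
    by (subst EP[symmetric], rule eq_matI) (auto simp: algebra_simps simp del: index_mult_mat(1))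
  \<comment> \<open>\<open>E\<close> fixes \<open>E * P\<close>, so this term occurs twice in the
    product; hence the coefficient \<open>- \<i> / 2\<close>.\<close>
  also have "\<dots> = (1\<^sub>m k + E) * (1\<^sub>m k + (- \<i> / 2) \<cdot>\<^sub>m (E * P))"
    by (simp add: distrib EEP, rule eq_matI) (auto simp: algebra_simps simp del: index_mult_mat(1))
  finally have "(1\<^sub>m k + (- \<i>) \<cdot>\<^sub>m P) * (1\<^sub>m k + \<i> \<cdot>\<^sub>m (P * E))
      = (1\<^sub>m k + E) * (1\<^sub>m k + (- \<i> / 2) \<cdot>\<^sub>m (E * P))" .
  from arg_cong[OF this, of det]
  have "det (1\<^sub>m k + (- \<i>) \<cdot>\<^sub>m P) * det (1\<^sub>m k + \<i> \<cdot>\<^sub>m (P * E))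
      = det (1\<^sub>m k + E) * det (1\<^sub>m k + (- \<i> / 2) \<cdot>\<^sub>m (E * P))"
    by (simp add: det_mult[of _ k])
  moreover have "det (1\<^sub>m k + \<i> \<cdot>\<^sub>m (P * E)) = 1"
    by (rule det_one_add_idempotent_nilpotent[of E]) (simp_all add: distrib PEE EPE')
  moreover have "det (1\<^sub>m k + (- \<i> / 2) \<cdot>\<^sub>m (E * P)) = 1"
    by (rule det_one_add_idempotent_nilpotent[of E]) (simp_all add: distrib EEP EPE)
  ultimately show ?thesis by simp
qed

text \<open>The scalar 2 equals \<open>?C * ?Q\<close>, so \<open>?C\<close> splits off on the left
  without being inverted; Sylvester's identity then moves the other factor from size
  \<open>k\<close> to size \<open>l\<close>.\<close>

lemma det_involution_plus_product:
  fixes P :: "complex mat"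
  assumes P: "P \<in> carrier_mat k k" and K: "K \<in> carrier_mat k l" and L: "L \<in> carrier_mat l k"
    and PP: "P * P = 1\<^sub>m k"
  shows "det (1\<^sub>m k + (- \<i>) \<cdot>\<^sub>m P + 2 \<cdot>\<^sub>m (K * L))
    = det (1\<^sub>m k + (- \<i>) \<cdot>\<^sub>m P) * det (1\<^sub>m l + (L * K + \<i> \<cdot>\<^sub>m (L * (P * K))))"
proof -
  let ?C = "1\<^sub>m k + (- \<i>) \<cdot>\<^sub>m P" and ?Q = "1\<^sub>m k + \<i> \<cdot>\<^sub>m P"
  have C: "?C \<in> carrier_mat k k" and Q: "?Q \<in> carrier_mat k k" using P by auto
  have KL: "K * L \<in> carrier_mat k k" using K L by auto
  have QK: "?Q * K \<in> carrier_mat k l" using Q K by auto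
  have "?C * ?Q = ?C * 1\<^sub>m k + ?C * (\<i> \<cdot>\<^sub>m P)"
    using C P by (subst mult_add_distrib_mat[of _ k k _ k]) auto
  also have "?C * (\<i> \<cdot>\<^sub>m P) = \<i> \<cdot>\<^sub>m P + 1\<^sub>m k"
    using P PP by (subst add_mult_distrib_mat[of _ k k _ _ k])
      (auto simp: mult_smult_distrib[of _ k k _ k] mult_smult_assoc_mat[of _ k k _ k])
  also have "?C * 1\<^sub>m k + (\<i> \<cdot>\<^sub>m P + 1\<^sub>m k) = 2 \<cdot>\<^sub>m 1\<^sub>m k"
    using P by auto
  finally have CQ: "?C * ?Q = 2 \<cdot>\<^sub>m 1\<^sub>m k" .
  have "?C * (1\<^sub>m k + ?Q * K * L) = ?C + ?C * (?Q * K * L)"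
    using C QK L by (subst mult_add_distrib_mat[of _ k k _ k]) auto
  also have "?C * (?Q * K * L) = ?C * ?Q * (K * L)"
    using assoc_mult_mat[OF Q K L] assoc_mult_mat[OF C Q KL] by simp
  also have "\<dots> = 2 \<cdot>\<^sub>m (K * L)"
    unfolding CQ using KL by (subst mult_smult_assoc_mat[of _ k k _ k]) auto
  finally have "?C + 2 \<cdot>\<^sub>m (K * L) = ?C * (1\<^sub>m k + ?Q * K * L)" by simp
  then have "det (?C + 2 \<cdot>\<^sub>m (K * L)) = det ?C * det (1\<^sub>m k + ?Q * K * L)"
    using C QK L by (simp add: det_mult[of _ k])
  also have "det (1\<^sub>m k + ?Q * K * L) = det (1\<^sub>m l + L * (?Q * K))"
    by (rule det_one_add_mult_commute[OF QK L])
  also have "?Q * K = K + \<i> \<cdot>\<^sub>m (P * K)"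
    using P K by (subst add_mult_distrib_mat[of _ k k _ _ l])
      (auto simp: mult_smult_assoc_mat[of _ k k _ l])
  also have "L * (K + \<i> \<cdot>\<^sub>m (P * K)) = L * K + \<i> \<cdot>\<^sub>m (L * (P * K))"
    using P K L by (subst mult_add_distrib_mat[of _ l k _ l])
      (auto simp: mult_smult_distrib[of _ l k _ l])
  finally show ?thesis .
qed

section \<open>Kronecker products and sums over the group\<close>

lemma msum_eq_mat:
  assumes "finite A" and "\<And>g. g \<in> A \<Longrightarrow> F g \<in> carrier_mat k k"
  shows "msum k F A = mat k k (\<lambda>(i, j). \<Sum>g\<in>A. F g $$ (i, j))"
  using assms
proof (induction A rule: finite_induct)
  case empty
  interpret abelian_group "module_mat TYPE(complex) k k" by (rule abelian_group_mat)
  show ?case by (auto simp: msum_def module_mat_simps)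
next
  case (insert g A)
  interpret abelian_group "module_mat TYPE(complex) k k" by (rule abelian_group_mat)
  have "msum k F (insert g A) = F g + msum k F A"
    unfolding msum_def using insert.hyps insert.prems
    by (subst finsum_insert) (auto simp: module_mat_simps)
  with insert show ?case by auto
qed

text \<open>At position \<open>i\<close>, \<open>List.product\<close> holds the pair of entries
  numbered \<open>i div length xs\<close> and \<open>i mod length xs\<close>, which is exactly the
  index splitting of the Kronecker product.\<close>

lemma kronecker_indexed_mat:
  assumes "A \<in> carrier_mat d d"
  shows "A \<otimes>\<^sub>K indexed_mat xs f
    = rect_mat (List.product [0..<d] xs) (List.product [0..<d] xs)
        (\<lambda>(a, x) (b, y). A $$ (a, b) * f x y)"
proof (rule eq_matI)
  fix i j
  let ?R = "rect_mat (List.product [0..<d] xs) (List.product [0..<d] xs)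
        (\<lambda>(a, x) (b, y). A $$ (a, b) * f x y)"
  assume "i < dim_row ?R" and "j < dim_col ?R"
  then have ij: "i < d * length xs" "j < d * length xs" by simp_all
  then have "0 < length xs" by (cases xs) auto
  then have "i div length xs < d" "j div length xs < d"
    "i mod length xs < length xs" "j mod length xs < length xs"
    using ij by (simp_all add: less_mult_imp_div_less)
  with ij assms show "(A \<otimes>\<^sub>K indexed_mat xs f) $$ (i, j) = ?R $$ (i, j)"
    by (simp add: kronecker_def indexed_mat_def rect_mat_def product_nth)
qed (use assms in \<open>simp_all add: kronecker_def indexed_mat_def\<close>)

lemma msum_kronecker_indexed_mat:
  assumes "finite A" and "\<And>g. g \<in> A \<Longrightarrow> \<rho> g \<in> carrier_mat d d"
  shows "msum (length xs * d) (\<lambda>g. \<rho> g \<otimes>\<^sub>K indexed_mat xs (f g)) A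
    = rect_mat (List.product [0..<d] xs) (List.product [0..<d] xs)
        (\<lambda>(a, x) (b, y). \<Sum>g\<in>A. \<rho> g $$ (a, b) * f g x y)"
proof -
  have "\<rho> g \<otimes>\<^sub>K indexed_mat xs (f g) \<in> carrier_mat (length xs * d) (length xs * d)" if "g \<in> A" for g
    unfolding kronecker_indexed_mat[OF assms(2)[OF that]] by (rule carrier_matI) simp_all
  then have "msum (length xs * d) (\<lambda>g. \<rho> g \<otimes>\<^sub>K indexed_mat xs (f g)) A
    = mat (length xs * d) (length xs * d)
       (\<lambda>(i, j). \<Sum>g\<in>A. (\<rho> g \<otimes>\<^sub>K indexed_mat xs (f g)) $$ (i, j))"
    by (rule msum_eq_mat[OF assms(1)])
  also have "\<dots> = mat (length xs * d) (length xs * d)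
       (\<lambda>(i, j). \<Sum>g\<in>A. rect_mat (List.product [0..<d] xs) (List.product [0..<d] xs)
        (\<lambda>(a, x) (b, y). \<rho> g $$ (a, b) * f g x y) $$ (i, j))"
    by (intro eq_matI) (auto simp: kronecker_indexed_mat[OF assms(2)] intro!: sum.cong)
  also have "\<dots> = rect_mat (List.product [0..<d] xs) (List.product [0..<d] xs)
        (\<lambda>(a, x) (b, y). \<Sum>g\<in>A. \<rho> g $$ (a, b) * f g x y)"
    by (rule eq_matI) (auto simp: rect_mat_def mult.commute case_prod_unfold)
  finally show ?thesis .
qed

lemma sum_set_product_upt:
  "(\<Sum>y\<in>set (List.product [0..<d] xs). F y) = (\<Sum>b<d. \<Sum>x\<in>set xs. F (b, x))"
  by (simp add: sum.cartesian_product atLeast0LessThan)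

lemma sum_if_eq_mult:
  fixes q :: "'a \<Rightarrow> 'b :: semiring_0"
  assumes "finite S"
  shows "(\<Sum>x\<in>S. (if x = c then p x else 0) * q x) = (if c \<in> S then p c * q c else 0)"
    and "(\<Sum>x\<in>S. (if c = x then p x else 0) * q x) = (if c \<in> S then p c * q c else 0)"
    and "(\<Sum>x\<in>S. q x * (if x = c then p x else 0)) = (if c \<in> S then q c * p c else 0)"
  using assms by (simp_all add: if_distrib[of "\<lambda>x. x * _"] if_distrib[of "\<lambda>x. _ * x"] cong: if_cong)

section \<open>Choosing an orientation of the edges\<close>

text \<open>An injective numbering of the vertices orients every edge towards the larger number.
  Every edge contains exactly one such arc, which gives the count.\<close>

lemma ex_orientation:
  fixes D :: "('v \<times> 'v) set"
  assumes "finite D" and sym: "\<And>e. e \<in> D \<Longrightarrow> prod.swap e \<in> D"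
    and irrefl: "\<And>e. e \<in> D \<Longrightarrow> fst e \<noteq> snd e"
  obtains A where "A \<subseteq> D" and "\<And>e. e \<in> D \<Longrightarrow> prod.swap e \<in> A \<longleftrightarrow> e \<notin> A"
    and "card A = card ((\<lambda>(u, v). {u, v}) ` D)"
proof -
  \<comment> \<open>Numbering the origins is enough: \<open>D\<close> is symmetric, so every
    terminus is also an origin.\<close>
  have "finite (fst ` D)" using assms by simp
  then obtain r :: "'v \<Rightarrow> nat" where r: "inj_on r (fst ` D)"
    using finite_imp_inj_to_nat_seg by metis
  define A where "A = {e \<in> D. r (fst e) < r (snd e)}"
  have ne: "r (fst e) \<noteq> r (snd e)" if "e \<in> D" for e
    using that irrefl[OF that] sym[OF that] r by (metis fst_swap imageI inj_onD)
  have alt: "prod.swap e \<in> A \<longleftrightarrow> e \<notin> A" if "e \<in> D" for e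
    using that sym[OF that] ne[OF that] by (auto simp: A_def)
  have "inj_on (\<lambda>(u, v). {u, v}) A"
    by (rule inj_onI) (auto simp: A_def doubleton_eq_iff)
  moreover have "(\<lambda>(u, v). {u, v}) ` A = (\<lambda>(u, v). {u, v}) ` D"
  proof
    show "(\<lambda>(u, v). {u, v}) ` D \<subseteq> (\<lambda>(u, v). {u, v}) ` A"
    proof clarify
      fix u v
      assume uv: "(u, v) \<in> D"
      show "{u, v} \<in> (\<lambda>(u, v). {u, v}) ` A"
      proof (cases "(u, v) \<in> A")
        case True
        then show ?thesis by force
      next
        case False
        then have "(v, u) \<in> A" using alt[OF uv] by simp
        then show ?thesis by (force simp: insert_commute)
      qed
    qed
  qed (auto simp: A_def)
  ultimately have "card A = card ((\<lambda>(u, v). {u, v}) ` D)"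
    using card_image by fastforce
  with alt show ?thesis by (intro that[of A]) (auto simp: A_def)
qed

section \<open>Reversal, head and tail matrices\<close>

text \<open>\<open>R e\<close> stands for the matrix \<rho>(\<alpha>(e)), \<open>s\<close> for the
  arc weights and \<open>X\<close> for the denominators. Group, voltages and representation enter
  only through \<open>R_inverse\<close>.\<close>

locale arc_matrices =
  fixes es :: "('v \<times> 'v) list" and vs :: "'v list" and d :: nat
    and R :: "'v \<times> 'v \<Rightarrow> nat \<Rightarrow> nat \<Rightarrow> complex"
    and s :: "'v \<times> 'v \<Rightarrow> complex" and X :: "'v \<Rightarrow> complex"
  assumes distinct_es: "distinct es" and distinct_vs: "distinct vs"
    and swap_arc: "e \<in> set es \<Longrightarrow> prod.swap e \<in> set es"
    and no_loop: "e \<in> set es \<Longrightarrow> fst e \<noteq> snd e"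
    and arc_fst: "e \<in> set es \<Longrightarrow> fst e \<in> set vs"
    and R_inverse: "\<lbrakk>e \<in> set es; a < d; c < d\<rbrakk>
      \<Longrightarrow> (\<Sum>b<d. R e a b * R (prod.swap e) b c) = (if a = c then 1 else 0)"
begin

lemma arc_snd: "e \<in> set es \<Longrightarrow> snd e \<in> set vs"
  using arc_fst[OF swap_arc] by simp

abbreviation arc_indices :: "(nat \<times> 'v \<times> 'v) list" where
  "arc_indices \<equiv> List.product [0..<d] es"

abbreviation vertex_indices :: "(nat \<times> 'v) list" where
  "vertex_indices \<equiv> List.product [0..<d] vs"

text \<open>This and the next two definitions are P, K and L of the overview. The representation
  occurs in P and K only, so entries of K L carry a single factor \<open>R\<close>.\<close>

definition reversal_mat :: "complex mat" where
  "reversal_mat = rect_mat arc_indices arc_indices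
     (\<lambda>x y. if snd y = prod.swap (snd x) then R (snd x) (fst x) (fst y) else 0)"

definition head_mat :: "complex mat" where
  "head_mat = rect_mat arc_indices vertex_indices
     (\<lambda>x y. if snd y = snd (snd x) then R (snd x) (fst x) (fst y) * s (snd x) / X (snd y) else 0)"

text \<open>The condition \<open>y = (fst x, snd y)\<close> is equality of the representation
  indices: L acts as the identity on the representation space.\<close>

definition tail_mat :: "complex mat" where
  "tail_mat = rect_mat vertex_indices arc_indices
     (\<lambda>x y. if y = (fst x, snd y) \<and> fst (snd y) = snd x then s (snd y) else 0)"

lemma distinct_indices: "distinct arc_indices" "distinct vertex_indices"
  by (simp_all add: distinct_product distinct_es distinct_vs)

text \<open>Two reversals return to the arc \<open>e\<close> and contribute \<open>R e\<close> times
  \<open>R (prod.swap e)\<close>, which is the identity.\<close>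

lemma reversal_mat_squared: "reversal_mat * reversal_mat = 1\<^sub>m (length arc_indices)"
  unfolding reversal_mat_def rect_mat_mult[OF distinct_indices(1)] rect_mat_one[OF distinct_indices(1)]
proof (rule rect_mat_cong, goal_cases)
  case (1 x z)
  obtain a e c g where xz: "x = (a, e)" "z = (c, g)"
    by (cases x, cases z)
  have "a < d" "c < d" "e \<in> set es" "g \<in> set es" using 1 by (auto simp: xz)
  then show ?case
    unfolding sum_set_product_upt xz fst_conv snd_conv
    by (cases "g = e") (auto simp: sum_if_eq_mult swap_arc R_inverse)
qed

lemma det_reversal_mat:
  "det (1\<^sub>m (length arc_indices) + (- \<i>) \<cdot>\<^sub>m reversal_mat)
    = 2 ^ (card ((\<lambda>(u, v). {u, v}) ` set es) * d)"
proof -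
  obtain A where A: "A \<subseteq> set es" and alt: "\<And>e. e \<in> set es \<Longrightarrow> prod.swap e \<in> A \<longleftrightarrow> e \<notin> A"
    and card_A: "card A = card ((\<lambda>(u, v). {u, v}) ` set es)"
    using ex_orientation[of "set es"] swap_arc no_loop by (metis List.finite_set)
  \<comment> \<open>\<open>c\<close> marks the chosen orientation \<open>A\<close>, so
    \<open>E\<close> is the projection onto its arcs.\<close>
  define c :: "nat \<times> 'v \<times> 'v \<Rightarrow> complex" where "c x = (if snd x \<in> A then 1 else 0)" for x
  define E where "E = rect_mat arc_indices arc_indices (\<lambda>x y. if x = y then c x else 0)"
  have E_left: "E * rect_mat arc_indices arc_indices f = rect_mat arc_indices arc_indices (\<lambda>x y. c x * f x y)"
    and E_right: "rect_mat arc_indices arc_indices f * E = rect_mat arc_indices arc_indices (\<lambda>x y. f x y * c y)"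
    for f
    unfolding E_def rect_mat_mult[OF distinct_indices(1)]
    by (rule rect_mat_cong; simp add: sum_if_eq_mult del: set_product)+
  have "det (1\<^sub>m (length arc_indices) + (- \<i>) \<cdot>\<^sub>m reversal_mat) = det (1\<^sub>m (length arc_indices) + E)"
  proof (rule det_one_minus_i_involution)
    show "reversal_mat \<in> carrier_mat (length arc_indices) (length arc_indices)"
      unfolding reversal_mat_def by (rule rect_mat_carrier)
    show "E \<in> carrier_mat (length arc_indices) (length arc_indices)"
      unfolding E_def by (rule rect_mat_carrier)
    show "E * E = E"
      unfolding E_def E_left[unfolded E_def] by (rule rect_mat_cong) (simp add: c_def)
    \<comment> \<open>P joins each arc to its reverse, and exactly one of the two lies in
      \<open>A\<close>: \<open>c x * c y = 0\<close> gives this equation, and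
      \<open>c x + c y = 1\<close> the next one.\<close>
    show "E * reversal_mat * E = 0\<^sub>m (length arc_indices) (length arc_indices)"
      unfolding reversal_mat_def E_left E_right rect_mat_zero
      by (rule rect_mat_cong) (simp add: c_def alt mem_Times_iff)
    show "E * reversal_mat + reversal_mat * E = reversal_mat"
      unfolding reversal_mat_def E_left E_right rect_mat_add
      by (rule rect_mat_cong) (simp add: c_def alt mem_Times_iff)
  qed (rule reversal_mat_squared)
  also have "1\<^sub>m (length arc_indices) + E = rect_mat arc_indices arc_indices (\<lambda>x y. if x = y then 1 + c x else 0)"
    unfolding E_def rect_mat_one[OF distinct_indices(1)] rect_mat_add
    by (rule rect_mat_cong) simp
  also have "det \<dots> = (\<Prod>x\<in>{0..<d} \<times> set es. if snd x \<in> A then 2 else 1)"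
    unfolding det_rect_mat_diag[OF distinct_indices(1)]
    by (rule prod.cong) (auto simp: c_def)
  also have "\<dots> = (\<Prod>x\<in>{0..<d} \<times> A. 2)"
    by (rule prod.mono_neutral_cong_right) (use A in auto)
  also have "\<dots> = 2 ^ (card A * d)"
    by (simp add: card_cartesian_product mult.commute)
  finally show ?thesis unfolding card_A .
qed

text \<open>Up to the factor -2 this is the part of the edge matrix without the Kronecker delta; the
  only intermediate vertex is the head of the first arc.\<close>

lemma head_mat_tail_mat:
  "head_mat * tail_mat = rect_mat arc_indices arc_indices
     (\<lambda>x y. if snd (snd x) = fst (snd y)
       then R (snd x) (fst x) (fst y) * s (snd x) * s (snd y) / X (snd (snd x)) else 0)"
  unfolding head_mat_def tail_mat_def rect_mat_mult[OF distinct_indices(2)]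
proof (rule rect_mat_cong, goal_cases)
  case (1 x z)
  obtain a e c f where xz: "x = (a, e)" "z = (c, f)"
    by (cases x, cases z)
  have "a < d" "c < d" "e \<in> set es" "f \<in> set es" using 1 by (auto simp: xz)
  then have *: "(\<Sum>y\<in>set vs. (if y = snd e then R e a b * s e / X y else 0)
        * (if c = b \<and> fst f = y then s f else 0))
     = (if c = b then if snd e = fst f then R e a b * s e * s f / X (snd e) else 0 else 0)" for b
    using arc_snd[of e] by (subst sum.remove[of _ "snd e"]) (auto intro!: sum.neutral)
  show ?case
    unfolding sum_set_product_upt xz fst_conv snd_conv using \<open>c < d\<close> by (simp add: *)
qed

text \<open>The right factor is arbitrary because both L K and L (P K) are needed.\<close>

lemma tail_mat_mult:
  "tail_mat * rect_mat arc_indices zs F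
    = rect_mat vertex_indices zs (\<lambda>x z. \<Sum>f\<in>{f \<in> set es. fst f = snd x}. s f * F (fst x, f) z)"
  unfolding tail_mat_def rect_mat_mult[OF distinct_indices(1)]
proof (rule rect_mat_cong, goal_cases)
  case (1 x z)
  obtain a u where x: "x = (a, u)" by (cases x)
  have "a < d" using 1 by (auto simp: x)
  have *: "(\<Sum>f\<in>set es. (if b = a \<and> fst f = u then s f else 0) * F (b, f) z)
     = (if b = a then \<Sum>f\<in>{f \<in> set es. fst f = u}. s f * F (b, f) z else 0)" for b
    by (auto simp: sum.inter_filter intro!: sum.cong)
  show ?case
    unfolding sum_set_product_upt x fst_conv snd_conv using \<open>a < d\<close> by (simp add: *)
qed

text \<open>At most one arc joins \<open>u\<close> to \<open>v\<close>, so a single term survives;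
  its squared weight will be an off-diagonal entry of H.\<close>

lemma tail_mat_head_mat:
  "tail_mat * head_mat = rect_mat vertex_indices vertex_indices
     (\<lambda>x y. if (snd x, snd y) \<in> set es
        then R (snd x, snd y) (fst x) (fst y) * s (snd x, snd y) ^ 2 / X (snd y) else 0)"
  unfolding head_mat_def tail_mat_mult
proof (rule rect_mat_cong, goal_cases)
  case (1 x y)
  obtain a u b v where xy: "x = (a, u)" "y = (b, v)"
    by (cases x, cases y)
  have "(\<Sum>f\<in>{f \<in> set es. fst f = u}. s f * (if v = snd f then R f a b * s f / X v else 0))
     = (\<Sum>f\<in>{f \<in> set es. f = (u, v)}. s f * (R f a b * s f / X v))"
    by (rule sum.mono_neutral_cong_right) auto
  also have "{f \<in> set es. f = (u, v)} = (if (u, v) \<in> set es then {(u, v)} else {})" by auto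
  finally show ?case
    unfolding xy fst_conv snd_conv by (auto simp: power2_eq_square)
qed

text \<open>The two factors \<open>R\<close> cancel, leaving the identity on the representation
  space, and the head of the reversed arc is the origin of the arc.\<close>

lemma reversal_mat_head_mat:
  "reversal_mat * head_mat = rect_mat arc_indices vertex_indices
     (\<lambda>x y. if x = (fst y, snd x) \<and> fst (snd x) = snd y
        then s (prod.swap (snd x)) / X (snd y) else 0)"
  unfolding reversal_mat_def head_mat_def rect_mat_mult[OF distinct_indices(1)]
proof (rule rect_mat_cong, goal_cases)
  case (1 x y)
  obtain a e b v where xy: "x = (a, e)" "y = (b, v)"
    by (cases x, cases y)
  have mem: "a < d" "b < d" "e \<in> set es" using 1 by (auto simp: xy)
  have "(\<Sum>c<d. \<Sum>f\<in>set es. (if f = prod.swap e then R e a c else 0)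
      * (if v = snd f then R f c b * s f / X v else 0))
    = (\<Sum>c<d. R e a c * R (prod.swap e) c b) * (if v = fst e then s (prod.swap e) / X v else 0)"
    using mem by (simp add: sum_if_eq_mult swap_arc sum_distrib_right mult.assoc)
  also have "\<dots> = (if a = b \<and> fst e = v then s (prod.swap e) / X v else 0)"
    using mem by (simp add: R_inverse)
  finally show ?case
    unfolding sum_set_product_upt xy fst_conv snd_conv by simp
qed

text \<open>Going out along an arc and back returns to the starting vertex, so the product is
  diagonal; its numerator becomes \<Gamma>_u once the phases cancel.\<close>

lemma tail_mat_reversal_mat_head_mat:
  "tail_mat * (reversal_mat * head_mat) = rect_mat vertex_indices vertex_indices
     (\<lambda>x y. if x = y
        then (\<Sum>f\<in>{f \<in> set es. fst f = snd x}. s f * s (prod.swap f)) / X (snd x) else 0)"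
  unfolding reversal_mat_head_mat tail_mat_mult
  by (rule rect_mat_cong) (auto simp: sum_divide_distrib intro!: sum.neutral sum.cong split: if_splits)

text \<open>Both matrices are written out entrywise so that they can be compared with the Kronecker
  sums of the theorem.\<close>

lemma det_arc_mat:
  "det (rect_mat arc_indices arc_indices (\<lambda>x y. (if x = y then 1 else 0)
      - (if snd (snd x) = fst (snd y)
         then R (snd x) (fst x) (fst y)
           * (\<i> * (if prod.swap (snd x) = snd y then 1 else 0) - 2 * (s (snd x) * s (snd y) / X (snd (snd x))))
         else 0)))
    = 2 ^ (card ((\<lambda>(u, v). {u, v}) ` set es) * d)
      * det (rect_mat vertex_indices vertex_indices (\<lambda>x y. (if x = y then 1 else 0)
          + ((if (snd x, snd y) \<in> set es
              then R (snd x, snd y) (fst x) (fst y) * s (snd x, snd y) ^ 2 / X (snd y) else 0)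
            + \<i> * (if x = y
                then (\<Sum>f\<in>{f \<in> set es. fst f = snd x}. s f * s (prod.swap f)) / X (snd x) else 0))))"
  (is "det ?L = _ * det ?M")
proof -
  have "?L = 1\<^sub>m (length arc_indices) + (- \<i>) \<cdot>\<^sub>m reversal_mat + 2 \<cdot>\<^sub>m (head_mat * tail_mat)"
    unfolding head_mat_tail_mat reversal_mat_def rect_mat_one[OF distinct_indices(1)] rect_mat_smult rect_mat_add
    by (rule rect_mat_cong) (auto simp: algebra_simps)
  also have "det \<dots> = det (1\<^sub>m (length arc_indices) + (- \<i>) \<cdot>\<^sub>m reversal_mat)
     * det (1\<^sub>m (length vertex_indices)
         + (tail_mat * head_mat + \<i> \<cdot>\<^sub>m (tail_mat * (reversal_mat * head_mat))))"
    by (rule det_involution_plus_product[OF _ _ _ reversal_mat_squared])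
      (unfold reversal_mat_def head_mat_def tail_mat_def, (rule rect_mat_carrier)+)
  also have "1\<^sub>m (length vertex_indices)
         + (tail_mat * head_mat + \<i> \<cdot>\<^sub>m (tail_mat * (reversal_mat * head_mat))) = ?M"
    unfolding tail_mat_head_mat tail_mat_reversal_mat_head_mat rect_mat_one[OF distinct_indices(2)]
      rect_mat_smult rect_mat_add ..
  finally show ?thesis unfolding det_reversal_mat .
qed

end

section \<open>Evaluation of the L-function\<close>

lemma diag_part_H_mat:
  assumes "distinct vs"
  shows "diag_part (H_mat G Hd h \<gamma> vs) = indexed_mat vs (\<lambda>u v. if u = v then of_real (Hd u) else 0)"
  by (rule eq_matI)
    (use assms in \<open>auto simp: diag_part_def mat_diag_def H_mat_def indexed_mat_def nth_eq_iff_index_eq\<close>)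

theorem theorem7:
  fixes G :: "'v pair_pre_digraph"
    and \<Gamma> :: "('g, 'b) monoid_scheme"
    and Hd :: "'v \<Rightarrow> real"
    and h \<gamma> :: "'v \<times> 'v \<Rightarrow> real"
    and \<alpha> :: "'v \<times> 'v \<Rightarrow> 'g"
    and \<rho> :: "'g \<Rightarrow> complex mat"
    and z :: complex
    and n m d :: nat
    and vs :: "'v list"
    and es :: "('v \<times> 'v) list"
  assumes "pair_graph G"
    and "Digraph_Component.connected (with_proj G)"
    and "n = card (pverts G)"
    and "m = card (edges G)"
    and "enumerates vs (pverts G)"
    and "enumerates es (parcs G)"
    and "\<And>f. f \<in> parcs G \<Longrightarrow> 0 \<le> h f"
    and "\<And>f. f \<in> parcs G \<Longrightarrow> \<gamma> f \<in> {- pi / 2 .. pi / 2}"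
    and "\<And>f. f \<in> parcs G \<Longrightarrow> h (prod.swap f) = h f"
    and "\<And>f. f \<in> parcs G \<Longrightarrow> \<gamma> (prod.swap f) = - \<gamma> f"
    and "group \<Gamma>"
    and "finite (carrier \<Gamma>)"
    and "voltage_assignment G \<Gamma> \<alpha>"
    and "\<rho> \<in> hom \<Gamma> (unitary_group d)"
    and "\<And>u. u \<in> pverts G \<Longrightarrow> of_real (Hd u) - z - \<i> * of_real (vweight G h u) \<noteq> 0"
  shows "inverse (L_function G Hd h \<gamma> es \<Gamma> z d \<rho> \<alpha>) =
    2 ^ (m * d) * (- 1) ^ (n * d)
      / (\<Prod>u \<in> pverts G. (of_real (Hd u) - z - \<i> * of_real (vweight G h u)) ^ d)
      * det (z \<cdot>\<^sub>m 1\<^sub>m (n * d)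
             - msum (n * d) (\<lambda>g. \<rho> g \<otimes>\<^sub>K Hg_mat G h \<gamma> \<alpha> vs g) (carrier \<Gamma>)
             - 1\<^sub>m d \<otimes>\<^sub>K diag_part (H_mat G Hd h \<gamma> vs))"
proof -
  interpret pair_graph G by (rule assms(1))
  interpret group \<Gamma> by (rule assms(11))
  have es: "distinct es" "set es = parcs G" and vs: "distinct vs" "set vs = pverts G"
    using assms(5,6) by (auto simp: enumerates_def)
  have length_vs: "length vs = n"
    using assms(3) vs distinct_card by fastforce
  have swap: "prod.swap e \<in> parcs G" if "e \<in> parcs G" for e
    using pair_sym_arcs that by (cases e) (auto simp: symmetric_def elim: symE)
  have \<alpha>_mem: "\<alpha> e \<in> carrier \<Gamma>" and \<alpha>_swap: "\<alpha> (prod.swap e) = inv\<^bsub>\<Gamma>\<^esub> \<alpha> e" if "e \<in> parcs G" for e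
    using assms(13) that by (auto simp: voltage_assignment_def)
  have \<rho>_carrier: "\<rho> g \<in> carrier_mat d d" if "g \<in> carrier \<Gamma>" for g
    using hom_in_carrier[OF assms(14) that] by (simp add: unitary_group_def)
  have \<rho>_mult: "\<rho> (g \<otimes>\<^bsub>\<Gamma>\<^esub> k) = \<rho> g * \<rho> k" if "g \<in> carrier \<Gamma>" "k \<in> carrier \<Gamma>" for g k
    using hom_mult[OF assms(14) that] by (simp add: unitary_group_def)
  \<comment> \<open>\<open>hom\<close> only requires multiplicativity. The image of the unit is
    idempotent and its adjoint is a left inverse, hence it is the identity.\<close>
  have \<rho>_one: "\<rho> \<one>\<^bsub>\<Gamma>\<^esub> = 1\<^sub>m d"
  proof -
    let ?A = "\<rho> \<one>\<^bsub>\<Gamma>\<^esub>"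
    have A: "?A \<in> carrier_mat d d" and adj: "mat_adjoint ?A * ?A = 1\<^sub>m d"
      using hom_in_carrier[OF assms(14) one_closed] by (simp_all add: unitary_group_def)
    have adjA: "mat_adjoint ?A \<in> carrier_mat d d"
      using A by (auto simp: mat_adjoint_def)
    have "mat_adjoint ?A * (?A * ?A) = ?A"
      using assoc_mult_mat[OF adjA A A] adj left_mult_one_mat[OF A] by simp
    moreover have "?A * ?A = ?A"
      using \<rho>_mult[of "\<one>\<^bsub>\<Gamma>\<^esub>" "\<one>\<^bsub>\<Gamma>\<^esub>"] by simp
    ultimately show ?thesis using adj by simp
  qed

  define R where "R e a b = \<rho> (\<alpha> e) $$ (a, b)" for e a b
  define s :: "'v \<times> 'v \<Rightarrow> complex" where "s e = of_real (sqrt (h e)) * exp (\<i> * of_real (\<gamma> e))" for e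
  define X :: "'v \<Rightarrow> complex" where "X u = of_real (Hd u) - z - \<i> * of_real (vweight G h u)" for u
  have X_nz: "X u \<noteq> 0" if "u \<in> pverts G" for u
    using assms(15)[OF that] by (simp add: X_def)
  have sqrt_sq: "complex_of_real (sqrt (h f)) * of_real (sqrt (h f)) = of_real (h f)" if "f \<in> parcs G" for f
    using assms(7)[OF that] by (simp flip: of_real_mult)
  \<comment> \<open>This is the arc entry of the matrices \<open>Hg_mat\<close>.\<close>
  have s_sq: "s f ^ 2 = of_real (h f) * exp (2 * \<i> * of_real (\<gamma> f))" if "f \<in> parcs G" for f
  proof -
    have "s f ^ 2 = (of_real (sqrt (h f)) * of_real (sqrt (h f))) * exp (\<i> * of_real (\<gamma> f)) ^ 2"
      by (simp add: s_def power2_eq_square)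
    then show ?thesis
      by (simp only: sqrt_sq[OF that] exp_double[symmetric] mult.assoc)
  qed
  \<comment> \<open>Under reversal the weight is symmetric and the angle antisymmetric, so the
    phases cancel.\<close>
  have s_swap: "s f * s (prod.swap f) = of_real (h f)" if "f \<in> parcs G" for f
  proof -
    have "s f * s (prod.swap f) = (of_real (sqrt (h f)) * of_real (sqrt (h f)))
        * (exp (\<i> * of_real (\<gamma> f)) * exp (- (\<i> * of_real (\<gamma> f))))"
      using assms(9,10)[OF that] by (simp add: s_def)
    then show ?thesis
      by (simp only: sqrt_sq[OF that] exp_minus_inverse mult_1_right)
  qed

  interpret arc_matrices es vs d R s X
  proof
    fix e a c
    assume e: "e \<in> set es" and ac: "a < d" "c < d"
    have mem: "\<alpha> e \<in> carrier \<Gamma>" "\<alpha> (prod.swap e) \<in> carrier \<Gamma>"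
      using e swap \<alpha>_mem by (auto simp: es)
    have "\<rho> (\<alpha> e) * \<rho> (\<alpha> (prod.swap e)) = 1\<^sub>m d"
      using \<rho>_mult[OF mem] \<alpha>_swap[of e] e mem by (simp add: es \<rho>_one)
    then have "(\<rho> (\<alpha> e) * \<rho> (\<alpha> (prod.swap e))) $$ (a, c) = (if a = c then 1 else 0)"
      using ac by simp
    then show "(\<Sum>b<d. R e a b * R (prod.swap e) b c) = (if a = c then 1 else 0)"
      using ac \<rho>_carrier[OF mem(1)] \<rho>_carrier[OF mem(2)]
      by (simp add: R_def scalar_prod_def atLeast0LessThan)
  qed (use es vs swap pair_no_loops arc_fst_in_verts in auto)

  let ?M = "rect_mat vertex_indices vertex_indices (\<lambda>x y. (if x = y then 1 else 0)
          + ((if (snd x, snd y) \<in> set es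
              then R (snd x, snd y) (fst x) (fst y) * s (snd x, snd y) ^ 2 / X (snd y) else 0)
            + \<i> * (if x = y
                then (\<Sum>f\<in>{f \<in> set es. fst f = snd x}. s f * s (prod.swap f)) / X (snd x) else 0)))"
  let ?N = "z \<cdot>\<^sub>m 1\<^sub>m (n * d)
             - msum (n * d) (\<lambda>g. \<rho> g \<otimes>\<^sub>K Hg_mat G h \<gamma> \<alpha> vs g) (carrier \<Gamma>)
             - 1\<^sub>m d \<otimes>\<^sub>K diag_part (H_mat G Hd h \<gamma> vs)"

  have one_es: "1\<^sub>m (length es * d) = rect_mat arc_indices arc_indices (\<lambda>x y. if x = y then 1 else 0)"
    using rect_mat_one[OF distinct_indices(1)] by (simp add: mult.commute)
  have one_vs: "1\<^sub>m (n * d) = rect_mat vertex_indices vertex_indices (\<lambda>x y. if x = y then 1 else 0)"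
    using rect_mat_one[OF distinct_indices(2)] by (simp add: mult.commute length_vs)

  have msum_es: "msum (length es * d) (\<lambda>g. \<rho> g \<otimes>\<^sub>K Ug_mat G Hd h \<gamma> z \<alpha> es g) (carrier \<Gamma>)
    = rect_mat arc_indices arc_indices (\<lambda>(a, e) (b, f).
        \<Sum>g\<in>carrier \<Gamma>. \<rho> g $$ (a, b) * (if snd e = fst f \<and> \<alpha> e = g
           then scattering G Hd h \<gamma> z (snd e) e f else 0))"
    unfolding Ug_mat_def by (rule msum_kronecker_indexed_mat[OF assms(12) \<rho>_carrier])
  \<comment> \<open>\<open>inverse_inverse_eq\<close> covers 0 as well, so a vanishing determinant
    needs no separate case.\<close>
  have "inverse (L_function G Hd h \<gamma> es \<Gamma> z d \<rho> \<alpha>)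
    = det (rect_mat arc_indices arc_indices (\<lambda>x y. (if x = y then 1 else 0)
      - (if snd (snd x) = fst (snd y)
         then R (snd x) (fst x) (fst y)
           * (\<i> * (if prod.swap (snd x) = snd y then 1 else 0) - 2 * (s (snd x) * s (snd y) / X (snd (snd x))))
         else 0)))"
    unfolding L_function_def inverse_inverse_eq one_es msum_es rect_mat_minus
  proof (rule arg_cong[of _ _ det], rule rect_mat_cong, goal_cases)
    case (1 x y)
    obtain a e b f where xy: "x = (a, e)" "y = (b, f)"
      by (cases x, cases y)
    have e: "e \<in> parcs G" using 1 by (auto simp: xy es)
    have "scattering G Hd h \<gamma> z (snd e) e f
      = \<i> * (if prod.swap e = f then 1 else 0) - 2 * (s e * s f / X (snd e))"
      by (simp add: scattering_def s_def X_def exp_add distrib_left mult_ac)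
    \<comment> \<open>Only the summand at \<open>g = \<alpha> e\<close> survives.\<close>
    moreover have "(\<Sum>g\<in>carrier \<Gamma>. \<rho> g $$ (a, b)
        * (if snd e = fst f \<and> \<alpha> e = g then scattering G Hd h \<gamma> z (snd e) e f else 0))
      = (if snd e = fst f then R e a b * scattering G Hd h \<gamma> z (snd e) e f else 0)"
      using \<alpha>_mem[OF e] assms(12)
      by (subst sum.remove[of _ "\<alpha> e"]) (auto simp: R_def intro!: sum.neutral split: if_splits)
    ultimately show ?case
      unfolding xy fst_conv snd_conv prod.case by (simp only: prod.inject)
  qed
  also have "\<dots> = 2 ^ (m * d) * det ?M"
    unfolding det_arc_mat by (simp add: assms(4) edges_def es)
  finally have L: "inverse (L_function G Hd h \<gamma> es \<Gamma> z d \<rho> \<alpha>) = 2 ^ (m * d) * det ?M" .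

  have msum_vs: "msum (n * d) (\<lambda>g. \<rho> g \<otimes>\<^sub>K Hg_mat G h \<gamma> \<alpha> vs g) (carrier \<Gamma>)
    = rect_mat vertex_indices vertex_indices (\<lambda>(a, u) (b, v).
        \<Sum>g\<in>carrier \<Gamma>. \<rho> g $$ (a, b) * (if (u, v) \<in> parcs G \<and> \<alpha> (u, v) = g
           then of_real (h (u, v)) * exp (2 * \<i> * of_real (\<gamma> (u, v))) else 0))"
    unfolding Hg_mat_def length_vs[symmetric]
    by (rule msum_kronecker_indexed_mat[OF assms(12) \<rho>_carrier])
  \<comment> \<open>Right multiplication by the diagonal matrix of the \<open>X v\<close> clears the
    column denominators; on the diagonal, \<open>X v\<close> plus i \<Gamma>_v becomes
    \<open>Hd v - z\<close>.\<close>
  have MX: "?M * rect_mat vertex_indices vertex_indices (\<lambda>x y. if x = y then X (snd x) else 0) = (- 1) \<cdot>\<^sub>m ?N"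
    unfolding msum_vs diag_part_H_mat[OF vs(1)] kronecker_indexed_mat[OF one_carrier_mat]
      one_vs rect_mat_smult rect_mat_minus rect_mat_mult[OF distinct_indices(2)]
  proof (rule rect_mat_cong, goal_cases)
    case (1 x y)
    obtain a u b v where xy: "x = (a, u)" "y = (b, v)"
      by (cases x, cases y)
    have mem: "a < d" "b < d" "u \<in> pverts G" "v \<in> pverts G" using 1 by (auto simp: xy vs)
    have weight: "(\<Sum>f\<in>{f \<in> set es. fst f = u}. s f * s (prod.swap f)) = of_real (vweight G h u)"
      by (simp add: vweight_def es s_swap)
    have hop: "(\<Sum>g\<in>carrier \<Gamma>. \<rho> g $$ (a, b) * (if (u, v) \<in> parcs G \<and> \<alpha> (u, v) = g
           then of_real (h (u, v)) * exp (2 * \<i> * of_real (\<gamma> (u, v))) else 0))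
      = (if (u, v) \<in> set es then R (u, v) a b * s (u, v) ^ 2 else 0)"
    proof (cases "(u, v) \<in> parcs G")
      case True
      then show ?thesis
        using \<alpha>_mem[OF True] assms(12)
        by (subst sum.remove[of _ "\<alpha> (u, v)"]) (auto simp: R_def es s_sq intro!: sum.neutral split: if_splits)
    qed (simp add: es)
    have diag: "of_real (Hd v) = X v + z + \<i> * of_real (vweight G h v)"
      by (simp add: X_def)
    \<comment> \<open>Without loops the adjacency term does not touch the diagonal.\<close>
    have "(v, v) \<notin> set es" using no_loop[of "(v, v)"] by auto
    then show ?case
      unfolding sum_if_eq_mult(3)[OF finite_set] if_P[OF 1(2)]
      unfolding xy fst_conv snd_conv prod.case weight hop
      using mem X_nz[of v] by (auto simp: field_simps diag)
  qed
  have N: "?N \<in> carrier_mat (n * d) (n * d)"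
    unfolding msum_vs diag_part_H_mat[OF vs(1)] kronecker_indexed_mat[OF one_carrier_mat]
    by (rule carrier_matI) (simp_all add: length_vs mult.commute)
  \<comment> \<open>The sign comes from scaling \<open>?N\<close>, of size \<open>n * d\<close>, by
    -1.\<close>
  have "det ?M * (\<Prod>x\<in>set vertex_indices. X (snd x)) = (- 1) ^ (n * d) * det ?N"
    unfolding det_rect_mat_diag[OF distinct_indices(2), symmetric]
      det_mult[OF rect_mat_carrier rect_mat_carrier, symmetric] MX det_smult carrier_matD(2)[OF N] ..
  \<comment> \<open>Each vertex occurs once for each of the \<open>d\<close> representation
    indices.\<close>
  also have "(\<Prod>x\<in>set vertex_indices. X (snd x)) = (\<Prod>u\<in>pverts G. X u ^ d)"
    using prod.cartesian_product[of "\<lambda>a. X" "pverts G" "{0..<d}"]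
    by (simp add: vs(2) case_prod_unfold prod_power_distrib)
  finally have "det ?M = (- 1) ^ (n * d) / (\<Prod>u\<in>pverts G. X u ^ d) * det ?N"
    using X_nz pair_finite_verts by (simp add: field_simps)
  then show ?thesis
    unfolding L by (simp add: X_def)
qed

end
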